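(* For the Restricted OWNM problem with weights in $[1,U]$, the (asymptotic) competitive ratio of every deterministic online algorithm is $O\!\left(2^{-\sqrt{\log U}}\right)$; that is, there is an absolute constant $C$ such that for all sufficiently large $U$, no deterministic online algorithm is $\rho$-competitive for any $\rho> C\cdot 2^{-\sqrt{\log U}}$.
   Context: Online Weighted Non-Crossing Matching (OWNM): the input is a sequence $p_1,\dots,p_{2n}$ of points in the Euclidean plane in general position, revealed online one at a time; when $p_i$ arrives its weight $w(p_i)>0$ is revealed. Upon arrival of $p_i$ an online algorithm must irrevocably either leave $p_i$ unmatched or match it with a previously arrived, currently unmatched point, subject to the constraint that the straight-line segments joining matched pairs are pairwise non-crossing. The profit $\textsc{ALG}(I)$ is the total weight of matched points, and $\textsc{OPT}(I)=\sum_i w(p_i)$. In the Restricted OWNM, all weights lie in $[1,U]$, where $U\ge1$ is known to the algorithm in advance. A deterministic algorithm is $\rho$-competitive if there is a constant $c$ (which may depend on $U$) with $\textsc{ALG}(I)\ge\rho\,\textsc{OPT}(I)-c$ for all inputs $I$. Here $\log$ is the base-2 logarithm. *)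

theory Defs
  imports "HOL-Analysis.Analysis"
begin

type_synonym point = "real ^ 2"

type_synonym request = "point \<times> real"

text \<open>
  A deterministic online algorithm maps the list of requests revealed so far (the last one being
  the point that has just arrived) to its irrevocable decision: \<open>None\<close> leaves the new point
  unmatched, \<open>Some j\<close> matches it with the point at (0-based) position \<open>j\<close>. Its earlier decisions
  are determined by the prefixes of the list, so they need not be passed as an argument. The
  algorithm is not told the length of the input.
\<close>
type_synonym algorithm = "request list \<Rightarrow> nat option"

abbreviation pt :: "request list \<Rightarrow> nat \<Rightarrow> point" where
  "pt I i \<equiv> fst (I ! i)"

abbreviation wt :: "request list \<Rightarrow> nat \<Rightarrow> real" where
  "wt I i \<equiv> snd (I ! i)"

definition general_position :: "point list \<Rightarrow> bool" where
  "general_position ps \<longleftrightarrow> distinct ps \<and>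
     (\<forall>a\<in>set ps. \<forall>b\<in>set ps. \<forall>c\<in>set ps.
        a \<noteq> b \<and> a \<noteq> c \<and> b \<noteq> c \<longrightarrow> \<not> collinear {a, b, c})"

text \<open>What can have been revealed at some moment; unlike a complete input, its length may be odd.\<close>
definition revealed :: "real \<Rightarrow> request list \<Rightarrow> bool" where
  "revealed U I \<longleftrightarrow> general_position (map fst I) \<and> (\<forall>i<length I. 1 \<le> wt I i \<and> wt I i \<le> U)"

definition instance_of :: "real \<Rightarrow> request list \<Rightarrow> bool" where
  "instance_of U I \<longleftrightarrow> revealed U I \<and> even (length I)"

text \<open>A pair \<open>(j, i)\<close> means that point \<open>i\<close> was matched, on its arrival, with point \<open>j\<close>.\<close>
definition matching :: "algorithm \<Rightarrow> request list \<Rightarrow> (nat \<times> nat) set" where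
  "matching A I = {(j, i). i < length I \<and> A (take (Suc i) I) = Some j}"

text \<open>
  For four distinct points in general position, two segments cross iff they intersect as closed
  segments.
\<close>
definition noncrossing_matching :: "request list \<Rightarrow> (nat \<times> nat) set \<Rightarrow> bool" where
  "noncrossing_matching I M \<longleftrightarrow>
     (\<forall>(j, i)\<in>M. j < i \<and> i < length I) \<and>
     (\<forall>(j, i)\<in>M. \<forall>(l, k)\<in>M. (j, i) \<noteq> (l, k) \<longrightarrow>
        {j, i} \<inter> {l, k} = {} \<and>
        closed_segment (pt I j) (pt I i) \<inter> closed_segment (pt I l) (pt I k) = {})"

definition online_algorithm :: "real \<Rightarrow> algorithm \<Rightarrow> bool" where
  "online_algorithm U A \<longleftrightarrow> (\<forall>I. revealed U I \<longrightarrow> noncrossing_matching I (matching A I))"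

definition matched :: "algorithm \<Rightarrow> request list \<Rightarrow> nat set" where
  "matched A I = {i. i < length I \<and> (\<exists>j. (i, j) \<in> matching A I \<or> (j, i) \<in> matching A I)}"

definition ALG :: "algorithm \<Rightarrow> request list \<Rightarrow> real" where
  "ALG A I = (\<Sum>i\<in>matched A I. wt I i)"

text \<open>
  An even number of points in general position always has a non-crossing perfect matching, so
  the offline optimum is the total weight.
\<close>
definition OPT :: "request list \<Rightarrow> real" where
  "OPT I = (\<Sum>i<length I. wt I i)"

definition competitive :: "real \<Rightarrow> real \<Rightarrow> algorithm \<Rightarrow> bool" where
  "competitive U \<rho> A \<longleftrightarrow> (\<exists>c. \<forall>I. instance_of U I \<longrightarrow> ALG A I \<ge> \<rho> * OPT I - c)"

end

theory Submission
  imports Defs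
begin

text \<open>
  All points lie on a parabola, where two chords cross iff their endpoints interleave. Put
  \<open>N = \<lfloor>sqrt (log 2 U)\<rfloor>\<close> and \<open>R = 2 ^ N\<close>. The adversary keeps sending points of weight 1 next to a
  cursor. Once such a point is matched, the chord splits the \<open>m\<close> visible unmatched points into two
  sides. If \<open>m \<ge> R\<close>, the adversary keeps only the smaller side, so that at least \<open>R / 2\<close> points
  have been sacrificed for a gain of 2. If \<open>m < R\<close>, it plays the weights \<open>R, R\<^sup>2, \<dots>\<close> in the smaller
  side, each match leaving less than half of the visible points, until one of the weights stays
  unmatched; that point outweighs all gains of this round by a factor of order \<open>R\<close>. The
  adversary then abandons this side for good and resumes on the other side of the first chord,
  where again only points of weight 1 are visible. With \<open>m\<close> weighted by \<open>4 / R\<close>, the potential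
  \<open>ALG - \<rho> * OPT + 4 * m / R\<close> drops by at least \<open>\<rho> - 4 / R\<close> in every round.
\<close>

section \<open>Chords of the parabola\<close>

definition parabola :: "real \<Rightarrow> point" where
  "parabola t = vector [t, t\<^sup>2]"

lemma parabola_nth [simp]: "parabola t $ 1 = t" "parabola t $ 2 = t\<^sup>2"
  by (simp_all add: parabola_def)

lemma parabola_eq_iff [simp]: "parabola s = parabola t \<longleftrightarrow> s = t"
  by (metis parabola_nth(1))

text \<open>For collinear points the determinant of two difference vectors vanishes; on the parabola
  it is, up to sign, the Vandermonde product of the three parameters.\<close>

lemma not_collinear_parabola:
  assumes "a \<noteq> b" "a \<noteq> c" "b \<noteq> c"
  shows "\<not> collinear {parabola a, parabola b, parabola c}"
proof
  assume "collinear {parabola a, parabola b, parabola c}"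
  then obtain u where u: "\<And>x y. x \<in> {parabola a, parabola b, parabola c} \<Longrightarrow>
      y \<in> {parabola a, parabola b, parabola c} \<Longrightarrow> \<exists>k. x - y = k *\<^sub>R u"
    unfolding collinear_def by blast
  obtain k where k: "parabola a - parabola b = k *\<^sub>R u"
    using u[of "parabola a" "parabola b"] by blast
  obtain m where m: "parabola a - parabola c = m *\<^sub>R u"
    using u[of "parabola a" "parabola c"] by blast
  have k12: "a - b = k * u $ 1" "a\<^sup>2 - b\<^sup>2 = k * u $ 2"
    using arg_cong[OF k, of "\<lambda>v. v $ 1"] arg_cong[OF k, of "\<lambda>v. v $ 2"] by simp_all
  have m12: "a - c = m * u $ 1" "a\<^sup>2 - c\<^sup>2 = m * u $ 2"
    using arg_cong[OF m, of "\<lambda>v. v $ 1"] arg_cong[OF m, of "\<lambda>v. v $ 2"] by simp_all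
  have "(a - b) * (a\<^sup>2 - c\<^sup>2) = (a - c) * (a\<^sup>2 - b\<^sup>2)"
    unfolding k12 m12 by simp
  then have "(a - b) * (a - c) * (c - b) = 0"
    by algebra
  with assms show False by simp
qed

lemma parabola_chords_cross_ordered:
  assumes "a < x" "x < b" "b < y"
  shows "closed_segment (parabola a) (parabola b) \<inter> closed_segment (parabola x) (parabola y) \<noteq> {}"
proof -
  define d where "d = x + y - a - b"
  have d: "d > 0" using assms by (simp add: d_def)
  \<comment> \<open>The line through the parameters \<open>a\<close> and \<open>b\<close> is
    \<open>Y = (a + b) * X - a * b\<close>; equating it with the line through \<open>x\<close> and
    \<open>y\<close> gives this abscissa.\<close>
  define X where "X = (x * y - a * b) / d"
  have X: "X * d = x * y - a * b" using d by (simp add: X_def)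
  define s where "s = (X - a) / (b - a)"
  define t where "t = (X - x) / (y - x)"
  \<comment> \<open>These products are positive, which puts \<open>X\<close> strictly inside both
    parameter intervals: the lines meet on the chords themselves.\<close>
  have "(X - a) * d = (x - a) * (y - a)" "(b - X) * d = (b - x) * (y - b)"
    "(X - x) * d = (x - a) * (b - x)" "(y - X) * d = (y - a) * (y - b)"
    using X by (auto simp: d_def algebra_simps)
  moreover have "(x - a) * (y - a) > 0" "(b - x) * (y - b) > 0"
    "(x - a) * (b - x) > 0" "(y - a) * (y - b) > 0"
    using assms by auto
  ultimately have bounds: "a < X" "X < b" "x < X" "X < y"
    using d by (metis diff_gt_0_iff_gt zero_less_mult_pos2)+
  define Z :: point where "Z = vector [X, (a + b) * X - a * b]"
  have st: "0 \<le> s" "s \<le> 1" "0 \<le> t" "t \<le> 1"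
    using bounds by (auto simp: s_def t_def)
  have s: "s * (b - a) = X - a" and t: "t * (y - x) = X - x"
    using assms by (auto simp: s_def t_def)
  have "Z = (1 - s) *\<^sub>R parabola a + s *\<^sub>R parabola b"
  proof -
    have "(1 - s) * a + s * b = X" using s by (simp add: algebra_simps)
    moreover have "(1 - s) * a\<^sup>2 + s * b\<^sup>2 = (a + b) * X - a * b"
      using s by algebra
    ultimately show ?thesis
      by (simp add: vec_eq_iff forall_2 Z_def)
  qed
  moreover have "Z = (1 - t) *\<^sub>R parabola x + t *\<^sub>R parabola y"
  proof -
    have "(1 - t) * x + t * y = X" using t by (simp add: algebra_simps)
    moreover have "(1 - t) * x\<^sup>2 + t * y\<^sup>2 = (x + y) * X - x * y"
      using t by algebra
    moreover have "(x + y) * X - x * y = (a + b) * X - a * b"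
      using X by (simp add: d_def algebra_simps)
    ultimately show ?thesis
      by (simp add: vec_eq_iff forall_2 Z_def)
  qed
  ultimately have "Z \<in> closed_segment (parabola a) (parabola b) \<inter> closed_segment (parabola x) (parabola y)"
    using st unfolding closed_segment_def by blast
  then show ?thesis by blast
qed

text \<open>Symmetric in \<open>a\<close> and \<open>b\<close>, because the order of arrival of two
  matched points says nothing about their order along the parabola.\<close>

definition between :: "real \<Rightarrow> real \<Rightarrow> real \<Rightarrow> bool" where
  "between a b x \<longleftrightarrow> min a b < x \<and> x < max a b"

lemma parabola_chords_cross:
  assumes "between a b x \<noteq> between a b y" "x \<notin> {a, b}" "y \<notin> {a, b}"
  shows "closed_segment (parabola a) (parabola b) \<inter> closed_segment (parabola x) (parabola y) \<noteq> {}"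
proof -
  have *: "closed_segment (parabola a) (parabola b) \<inter> closed_segment (parabola x) (parabola y) \<noteq> {}"
    if "a < b" "a < x" "x < b" "y < a \<or> b < y" for a b x y
    using that parabola_chords_cross_ordered[of a x b y] parabola_chords_cross_ordered[of y a x b]
    by (auto simp: closed_segment_commute Int_commute)
  consider "a < b" "a < x" "x < b" "y < a \<or> b < y" | "a < b" "a < y" "y < b" "x < a \<or> b < x"
    | "b < a" "b < x" "x < a" "y < b \<or> a < y" | "b < a" "b < y" "y < a" "x < b \<or> a < x"
    using assms unfolding between_def min_def max_def by (smt (verit) insert_iff)
  then show ?thesis
    by cases (use *[of a b x y] *[of a b y x] *[of b a x y] *[of b a y x]
      in \<open>auto simp: closed_segment_commute Int_commute\<close>)
qed

section \<open>Requests on the parabola and irrevocable decisions\<close>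

definition on_parabola :: "(real \<times> real) list \<Rightarrow> request list" where
  "on_parabola = map (map_prod parabola id)"

lemma length_on_parabola [simp]: "length (on_parabola L) = length L"
  by (simp add: on_parabola_def)

lemma nth_on_parabola [simp]:
  "i < length L \<Longrightarrow> on_parabola L ! i = (parabola (fst (L ! i)), snd (L ! i))"
  by (simp add: on_parabola_def map_prod_def case_prod_beta)

lemma on_parabola_append [simp]: "on_parabola (L @ K) = on_parabola L @ on_parabola K"
  by (simp add: on_parabola_def)

lemma general_position_on_parabola:
  assumes "distinct (map fst L)"
  shows "general_position (map fst (on_parabola L))"
proof -
  have *: "map fst (on_parabola L) = map parabola (map fst L)"
    by (simp add: on_parabola_def)
  have "distinct (map parabola (map fst L))"
    unfolding distinct_map[of parabola] using assms by (auto intro!: inj_onI)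
  then show ?thesis
    unfolding general_position_def * by (auto simp: not_collinear_parabola)
qed

lemma OPT_append_single: "OPT (I @ [x]) = OPT I + snd x"
  by (simp add: OPT_def lessThan_Suc nth_append)

text \<open>The decision on point \<open>i\<close> depends only on the prefix ending there, so
  chords persist in every continuation.\<close>

lemma matching_append_iff:
  "i < length I \<Longrightarrow> (j, i) \<in> matching A (I @ K) \<longleftrightarrow> (j, i) \<in> matching A I"
  by (simp add: matching_def Suc_le_eq)

lemma matching_append: "matching A I \<subseteq> matching A (I @ K)"
  by (auto simp: matching_def Suc_le_eq)

section \<open>The game against a fixed algorithm\<close>

locale online_matching =
  fixes U :: real and A :: algorithm
  assumes online: "online_algorithm U A" and one_le_U: "1 \<le> U"
begin

definition valid :: "(real \<times> real) list \<Rightarrow> bool" where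
  "valid L \<longleftrightarrow> distinct (map fst L) \<and> (\<forall>p\<in>set L. 1 \<le> snd p \<and> snd p \<le> U)"

abbreviation pairs :: "(real \<times> real) list \<Rightarrow> (nat \<times> nat) set" where
  "pairs L \<equiv> matching A (on_parabola L)"

abbreviation profit :: "(real \<times> real) list \<Rightarrow> real" where
  "profit L \<equiv> ALG A (on_parabola L)"

abbreviation total :: "(real \<times> real) list \<Rightarrow> real" where
  "total L \<equiv> OPT (on_parabola L)"

lemma revealed_on_parabola:
  assumes "valid L"
  shows "revealed U (on_parabola L)"
  using assms general_position_on_parabola unfolding revealed_def valid_def by simp

lemma valid_appendD: "valid (L @ K) \<Longrightarrow> valid L"
  by (auto simp: valid_def)

lemma pairs_less:
  assumes "valid L" "(j, i) \<in> pairs L"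
  shows "j < i" "i < length L"
proof -
  have "noncrossing_matching (on_parabola L) (pairs L)"
    using online revealed_on_parabola[OF assms(1)] by (simp add: online_algorithm_def)
  then show "j < i" "i < length L"
    using assms(2) unfolding noncrossing_matching_def by fastforce+
qed

text \<open>Otherwise the second chord would have its endpoints on different sides of the first, and
  \<open>parabola_chords_cross\<close> would yield a common point.\<close>

lemma pairs_noncrossing:
  assumes v: "valid L" and m: "(j, i) \<in> pairs L" "(j', i') \<in> pairs L" and ne: "i \<noteq> i'"
  shows "{j, i} \<inter> {j', i'} = {}"
    and "between (fst (L ! j)) (fst (L ! i)) (fst (L ! j')) =
         between (fst (L ! j)) (fst (L ! i)) (fst (L ! i'))"
proof -
  have nc: "noncrossing_matching (on_parabola L) (pairs L)"
    using online revealed_on_parabola[OF v] by (auto simp: online_algorithm_def)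
  have less: "j < i" "i < length L" "j' < i'" "i' < length L"
    using pairs_less[OF v] m by auto
  show disj: "{j, i} \<inter> {j', i'} = {}"
    using nc m ne unfolding noncrossing_matching_def by fastforce
  have seg: "closed_segment (parabola (fst (L ! j))) (parabola (fst (L ! i))) \<inter>
        closed_segment (parabola (fst (L ! j'))) (parabola (fst (L ! i'))) = {}"
    using nc m ne less unfolding noncrossing_matching_def by fastforce
  have inj: "fst (L ! a) \<noteq> fst (L ! b)" if "a \<noteq> b" "a < length L" "b < length L" for a b
    using v that unfolding valid_def by (metis distinct_conv_nth length_map nth_map)
  have "fst (L ! j') \<notin> {fst (L ! j), fst (L ! i)}" "fst (L ! i') \<notin> {fst (L ! j), fst (L ! i)}"
    using inj disj less by auto
  then show "between (fst (L ! j)) (fst (L ! i)) (fst (L ! j')) =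
         between (fst (L ! j)) (fst (L ! i)) (fst (L ! i'))"
    using parabola_chords_cross seg by blast
qed

text \<open>
  \<open>confined L S V\<close> is a property of all continuations of the game, whichever points they
  contain: a future point with parameter in \<open>S\<close> can be matched with an old point only if that is
  in \<open>V\<close>. So \<open>V\<close> bounds the set of unmatched points that are visible from \<open>S\<close>.
\<close>
definition confined :: "(real \<times> real) list \<Rightarrow> real set \<Rightarrow> nat set \<Rightarrow> bool" where
  "confined L S V \<longleftrightarrow> (\<forall>K j i. valid (L @ K) \<longrightarrow> (j, i) \<in> pairs (L @ K) \<longrightarrow> length L \<le> i \<longrightarrow>
     fst ((L @ K) ! i) \<in> S \<longrightarrow> j \<in> V \<or> length L \<le> j)"

text \<open>The separating chord is already matched, so it cuts off \<open>S\<close> from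
  \<open>T\<close> in all continuations.\<close>

definition separated :: "(real \<times> real) list \<Rightarrow> real set \<Rightarrow> real set \<Rightarrow> bool" where
  "separated L S T \<longleftrightarrow> (\<exists>(j, i)\<in>pairs L. \<forall>x\<in>S. \<forall>y\<in>T.
     between (fst (L ! j)) (fst (L ! i)) x \<noteq> between (fst (L ! j)) (fst (L ! i)) y)"

text \<open>The gap between \<open>l\<close> and \<open>r\<close> is where the next request goes. As
  visible points have weight 1, matching a newcomer of weight \<open>w\<close> gains at most
  \<open>1 + w\<close>.\<close>

definition state :: "(real \<times> real) list \<Rightarrow> real \<Rightarrow> real \<Rightarrow> nat set \<Rightarrow> bool" where
  "state L l r V \<longleftrightarrow> valid L \<and> l < r \<and> fst ` set L \<inter> {l<..<r} = {} \<and>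
     confined L {l<..<r} V \<and> V \<subseteq> {..<length L} \<and> (\<forall>v\<in>V. snd (L ! v) = 1)"

lemma state_finite: "state L l r V \<Longrightarrow> finite V"
  by (auto simp: state_def intro: finite_subset)

lemma separated_sym: "separated L S T \<Longrightarrow> separated L T S"
  unfolding separated_def by blast

lemma separated_disjoint: "separated L S T \<Longrightarrow> S \<inter> T = {}"
  unfolding separated_def by blast

section \<open>Effect of a single request\<close>

lemma pairs_append_single:
  assumes "valid (L @ [p])" "(j, i) \<in> pairs (L @ [p])" "i \<noteq> length L"
  shows "(j, i) \<in> pairs L"
proof -
  have "i < length (on_parabola L)" using pairs_less[OF assms(1,2)] assms(3) by simp
  then show ?thesis
    using assms(2) matching_append_iff[of i "on_parabola L" j A "on_parabola [p]"] by simp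
qed

lemma profit_append_unmatched:
  assumes "valid (L @ [p])" "\<And>j. (j, length L) \<notin> pairs (L @ [p])"
  shows "profit (L @ [p]) = profit L"
proof -
  have "(j, i) \<in> pairs (L @ [p]) \<longleftrightarrow> (j, i) \<in> pairs L" for i j
    using matching_append[of A "on_parabola L" "on_parabola [p]"]
      pairs_append_single[OF assms(1), of j i] assms(2)[of j] by auto
  moreover have "i < length L \<and> j < length L" if "(j, i) \<in> pairs L" for i j
    using pairs_less[OF valid_appendD[OF assms(1)] that] by simp
  ultimately have "matched A (on_parabola (L @ [p])) = matched A (on_parabola L)"
    unfolding matched_def by (intro Collect_cong) (auto simp del: on_parabola_append intro: less_SucI)
  then show ?thesis
    unfolding ALG_def by (intro sum.cong) (auto simp: matched_def nth_append_left)
qed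

lemma profit_append_matched:
  assumes "valid (L @ [p])" "(j, length L) \<in> pairs (L @ [p])"
  shows "profit (L @ [p]) \<le> profit L + snd (L ! j) + snd p"
proof -
  have pos: "0 \<le> snd ((L @ [p]) ! i)" if "i < Suc (length L)" for i
    using assms(1) that nth_mem[of i "L @ [p]"] unfolding valid_def by fastforce
  have j: "j < length L" using pairs_less[OF assms] by simp
  have uniq: "j' = j" if "(j', length L) \<in> pairs (L @ [p])" for j'
    using that assms(2) by (simp add: matching_def)
  have sub: "matched A (on_parabola (L @ [p])) \<subseteq> matched A (on_parabola L) \<union> {j, length L}"
  proof
    fix i assume "i \<in> matched A (on_parabola (L @ [p]))"
    then obtain k where "(i, k) \<in> pairs (L @ [p]) \<or> (k, i) \<in> pairs (L @ [p])"
      unfolding matched_def by blast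
    then have "i \<in> {j, length L} \<or> (i, k) \<in> pairs L \<or> (k, i) \<in> pairs L"
      using pairs_append_single[OF assms(1)] uniq by blast
    then show "i \<in> matched A (on_parabola L) \<union> {j, length L}"
      using pairs_less[OF valid_appendD[OF assms(1)]] unfolding matched_def by fastforce
  qed
  have fin: "finite (matched A (on_parabola L))"
    by (auto simp: matched_def)
  have ub: "i < length L" if "i \<in> matched A (on_parabola L)" for i
    using that by (simp add: matched_def)
  have "profit (L @ [p]) = (\<Sum>i\<in>matched A (on_parabola (L @ [p])). snd ((L @ [p]) ! i))"
    unfolding ALG_def by (intro sum.cong) (simp_all add: matched_def del: on_parabola_append)
  also have "\<dots> \<le> (\<Sum>i\<in>matched A (on_parabola L) \<union> {j, length L}. snd ((L @ [p]) ! i))"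
    using fin sub ub pos j by (intro sum_mono2) (auto simp: less_Suc_eq)
  also have "\<dots> \<le> (\<Sum>i\<in>matched A (on_parabola L). snd ((L @ [p]) ! i)) + (\<Sum>i\<in>{j, length L}. snd ((L @ [p]) ! i))"
  proof -
    have "0 \<le> (\<Sum>i\<in>matched A (on_parabola L) \<inter> {j, length L}. snd ((L @ [p]) ! i))"
      using ub pos by (intro sum_nonneg) (auto simp: less_Suc_eq)
    then show ?thesis
      using fin sum.union_inter[of "matched A (on_parabola L)" "{j, length L}" "\<lambda>i. snd ((L @ [p]) ! i)"]
      by simp
  qed
  also have "(\<Sum>i\<in>matched A (on_parabola L). snd ((L @ [p]) ! i)) = profit L"
    unfolding ALG_def using ub by (intro sum.cong) (simp_all add: nth_append_left)
  finally show ?thesis using j by (simp add: nth_append)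
qed

lemma valid_append_single:
  assumes "state L l r V" "l < q" "q < r" "1 \<le> w" "w \<le> U"
  shows "valid (L @ [(q, w)])"
  using assms unfolding state_def valid_def by (fastforce simp: image_iff)

lemma state_append_unmatched:
  assumes st: "state L l r V" and q: "l < q" "q < r"
  shows "state (L @ [(q, 1)]) l q (insert (length L) V)"
proof -
  have "confined (L @ [(q, 1)]) {l<..<q} (insert (length L) V)"
    unfolding confined_def
  proof (intro allI impI)
    fix K j i
    assume *: "valid ((L @ [(q, 1)]) @ K)" "(j, i) \<in> pairs ((L @ [(q, 1)]) @ K)"
      "length (L @ [(q, 1)]) \<le> i" "fst (((L @ [(q, 1)]) @ K) ! i) \<in> {l<..<q}"
    then have "j \<in> V \<or> length L \<le> j"
      using st q unfolding state_def confined_def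
      by fastforce
    then show "j \<in> insert (length L) V \<or> length (L @ [(q, 1)]) \<le> j"
      by auto
  qed
  then show ?thesis
    using st q valid_append_single[OF st q, of 1] one_le_U
    unfolding state_def by (auto simp: nth_append lessThan_Suc)
qed

text \<open>The chord from \<open>j\<close> to \<open>p\<close> uses up both endpoints, and a later
  point with parameter in \<open>T\<close> can only be matched on its own side of it.\<close>

lemma confined_split:
  assumes v: "valid L'" and L': "L' = L @ [p]" and m: "(j, length L) \<in> pairs L'"
    and conf: "confined L S V" and sub: "T \<subseteq> S"
    and side: "\<And>x. x \<in> T \<Longrightarrow> between (fst (L ! j)) (fst p) x = b"
  shows "confined L' T {v \<in> V - {j}. between (fst (L ! j)) (fst p) (fst (L ! v)) = b}"
    (is "confined _ _ ?W")
  unfolding confined_def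
proof (intro allI impI)
  fix K j' i'
  assume *: "valid (L' @ K)" "(j', i') \<in> pairs (L' @ K)" "length L' \<le> i'"
    "fst ((L' @ K) ! i') \<in> T"
  have jL: "j < length L" using pairs_less[OF v m] by simp
  have m': "(j, length L) \<in> pairs (L' @ K)"
    using m matching_append[of A "on_parabola L'" "on_parabola K"] by auto
  have ne: "length L \<noteq> i'" using * L' by auto
  have j: "(L' @ K) ! j = L ! j" "(L' @ K) ! length L = p" using jL by (auto simp: L' nth_append)
  from pairs_noncrossing[OF *(1) m' *(2) ne] side[OF *(4)]
  have nc: "j' \<noteq> j" "j' \<noteq> length L" "between (fst (L ! j)) (fst p) (fst ((L' @ K) ! j')) = b"
    by (auto simp: j)
  \<comment> \<open>Index \<open>length L\<close> belongs to \<open>p\<close>, which is already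
    matched; any partner outside \<open>V\<close> therefore comes after \<open>p\<close>.\<close>
  have "j' \<in> V \<or> length L \<le> j'"
    using conf * sub unfolding confined_def L' by fastforce
  then consider "j' \<in> V" "j' < length L" | "length L < j'" using nc by linarith
  then show "j' \<in> ?W \<or> length L' \<le> j'"
    using nc by cases (auto simp: L' nth_append)
qed

text \<open>The partner lies in \<open>V\<close> and outside the gap, so the chord separates the two
  halves of the gap at \<open>q\<close> and distributes the rest of \<open>V\<close> between
  them.\<close>

lemma state_append_matched:
  assumes st: "state L l r V" and q: "l < q" "q < r" and w: "1 \<le> w" "w \<le> U"
    and m: "(j, length L) \<in> pairs (L @ [(q, w)])"
  shows "profit (L @ [(q, w)]) \<le> profit L + 1 + w" (is ?gain)
    and "\<exists>l1 r1 V1 l2 r2 V2. state (L @ [(q, w)]) l1 r1 V1 \<and> state (L @ [(q, w)]) l2 r2 V2 \<and>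
      separated (L @ [(q, w)]) {l1<..<r1} {l2<..<r2} \<and> {l1<..<r1} \<subseteq> {l<..<r} \<and>
      2 * card V1 < card V \<and> card V2 < card V" (is ?split)
proof -
  let ?L = "L @ [(q, w)]"
  have v: "valid ?L" using valid_append_single[OF st q w] .
  have jL: "j < length L" using pairs_less[OF v m] by simp
  have fin: "finite V" using state_finite[OF st] .
  have conf: "confined L {l<..<r} V" using st by (simp add: state_def)
  have jV: "j \<in> V"
    using conf v m jL q unfolding confined_def by fastforce
  show ?gain
    using profit_append_matched[OF v m] st jV unfolding state_def by auto
  define t where "t = fst (L ! j)"
  have "t \<notin> {l<..<r}" using st nth_mem[OF jL] unfolding state_def t_def by blast
  then have t: "t \<le> l \<or> r \<le> t" by auto
  \<comment> \<open>The half of the gap facing the partner lies between the chord's endpoints: the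
    left half if \<open>b\<close> holds, the right half otherwise.\<close>
  define b where "b \<longleftrightarrow> t \<le> l"
  have left: "between t q x = b" if "x \<in> {l<..<q}" for x
    using that t q by (auto simp: between_def b_def)
  have right: "between t q x = (\<not> b)" if "x \<in> {q<..<r}" for x
    using that t q by (auto simp: between_def b_def)
  define W where "W c = {v \<in> V - {j}. between t q (fst (L ! v)) = c}" for c
  have "confined ?L {l<..<q} (W b)"
    unfolding W_def t_def
    by (rule confined_split[OF v refl m conf, unfolded fst_conv])
      (use left q in \<open>auto simp: t_def\<close>)
  moreover have "confined ?L {q<..<r} (W (\<not> b))"
    unfolding W_def t_def
    by (rule confined_split[OF v refl m conf, unfolded fst_conv])
      (use right q in \<open>auto simp: t_def\<close>)
  ultimately have states: "state ?L l q (W b)" "state ?L q r (W (\<not> b))"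
    using st q v unfolding state_def W_def by (auto simp: nth_append)
  have sep: "separated ?L {l<..<q} {q<..<r}"
    unfolding separated_def
    by (intro bexI[OF _ m]) (use left right jL in \<open>simp add: nth_append t_def\<close>)
  have "W b \<union> W (\<not> b) = V - {j}" "W b \<inter> W (\<not> b) = {}"
    by (auto simp: W_def)
  moreover have "finite (W b)" "finite (W (\<not> b))"
    using fin by (auto simp: W_def)
  ultimately have "card (V - {j}) = card (W b) + card (W (\<not> b))"
    by (metis card_Un_disjoint)
  then have card: "card (W b) + card (W (\<not> b)) + 1 = card V"
    using card_Suc_Diff1[OF fin jV] by simp
  show ?split
  \<comment> \<open>The two sides share \<open>card V - 1\<close> points, so the smaller one has
    less than half of \<open>card V\<close>.\<close>
  proof (cases "card (W b) \<le> card (W (\<not> b))")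
    case True
    then show ?thesis using states sep card q
      by (intro exI[of _ l] exI[of _ q] exI[of _ "W b"] exI[of _ r] exI[of _ "W (\<not> b)"]) auto
  next
    case False
    then show ?thesis using states separated_sym[OF sep] card q
      by (intro exI[of _ l] exI[of _ q] exI[of _ "W b"] exI[of _ r] exI[of _ "W (\<not> b)"]) auto
  qed
qed

section \<open>Rounds of the adversary and the potential\<close>

text \<open>This allows resuming on the other side after an escalation: the separating chord hides
  all points of \<open>J\<close> from the gap, so \<open>V\<close> does not grow.\<close>

lemma state_append_elsewhere:
  assumes st: "state L l r V" and sep: "separated L S {l<..<r}"
    and v: "valid (L @ J)" and J: "fst ` set J \<subseteq> S"
  shows "state (L @ J) l r V"
proof -
  obtain a b where ab: "(a, b) \<in> pairs L" "\<And>x y. x \<in> S \<Longrightarrow> y \<in> {l<..<r} \<Longrightarrow>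
      between (fst (L ! a)) (fst (L ! b)) x \<noteq> between (fst (L ! a)) (fst (L ! b)) y"
    using sep unfolding separated_def by blast
  have len: "a < length L" "b < length L"
    using pairs_less[OF valid_appendD[OF v] ab(1)] by auto
  have "confined (L @ J) {l<..<r} V"
    unfolding confined_def
  proof (intro allI impI)
    fix K j i
    assume *: "valid ((L @ J) @ K)" "(j, i) \<in> pairs ((L @ J) @ K)" "length (L @ J) \<le> i"
      "fst (((L @ J) @ K) ! i) \<in> {l<..<r}"
    have "j \<in> V \<or> length L \<le> j"
      using st * unfolding state_def confined_def
      by (metis append_assoc le_add1 le_trans length_append)
    moreover have False if j: "length L \<le> j" "j < length (L @ J)"
    proof -
      have "((L @ J) @ K) ! j \<in> set J"
        using j by (auto simp: nth_append)
      then have S: "fst (((L @ J) @ K) ! j) \<in> S" using J by blast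
      have "(a, b) \<in> pairs ((L @ J) @ K)"
        using ab(1) matching_append[of A "on_parabola L" "on_parabola (J @ K)"] by auto
      moreover have "b \<noteq> i" using len * by auto
      ultimately show False
        using pairs_noncrossing(2)[OF *(1) _ *(2), of a b] ab(2)[OF S *(4)] len
        by (simp add: nth_append_left)
    qed
    ultimately show "j \<in> V \<or> length (L @ J) \<le> j" by fastforce
  qed
  moreover have "fst ` set J \<inter> {l<..<r} = {}"
    using separated_disjoint[OF sep] J by blast
  ultimately show ?thesis
    using st v unfolding state_def by (auto simp: nth_append)
qed

text \<open>
  The weights \<open>R\<^sup>i, R\<^sup>i\<^sup>+\<^sup>1, \<dots>\<close> are sent until one of them stays unmatched. As every match halves the
  set of visible points, this happens at weight \<open>R\<^sup>N\<close> at the latest.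
\<close>
lemma escalation:
  fixes N :: nat
  defines "R \<equiv> 2 ^ N :: real"
  assumes "state L l r V" "card V < 2 ^ (N - i)" "1 \<le> i" "i \<le> N" "R ^ N \<le> U"
  shows "\<exists>J. valid (L @ J) \<and> fst ` set J \<subseteq> {l<..<r} \<and>
    profit (L @ J) + 2 * R ^ (i - 1) \<le> profit L + 2 / R * (total (L @ J) - total L)"
  using assms(2-)
proof (induction "N - i" arbitrary: i L l r V rule: less_induct)
  case less
  note st = less.prems(1)
  have R: "1 \<le> R" by (simp add: R_def)
  define q where "q = (l + r) / 2"
  have q: "l < q" "q < r" using st by (auto simp: state_def q_def)
  have w: "1 \<le> R ^ i" "R ^ i \<le> U"
    using R less.prems power_increasing[of i N R] by auto
  have Ri: "R ^ i = R * R ^ (i - 1)" using less.prems by (cases i) auto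
  let ?L = "L @ [(q, R ^ i)]"
  have v: "valid ?L" using valid_append_single[OF st q w] .
  have tot: "total ?L = total L + R ^ i" by (simp add: OPT_append_single on_parabola_def)
  show ?case
  proof (cases "\<exists>j. (j, length L) \<in> pairs ?L")
    case False
    then have "profit ?L = profit L" using profit_append_unmatched[OF v] by blast
    \<comment> \<open>The unmatched weight \<open>R ^ i\<close> alone pays for the claimed surplus,
      with equality.\<close>
    moreover have "2 * R ^ (i - 1) = 2 / R * (total ?L - total L)"
      unfolding tot using R Ri by simp
    ultimately show ?thesis using v q by (intro exI[of _ "[(q, R ^ i)]"]) simp
  next
    case True
    then obtain j where m: "(j, length L) \<in> pairs ?L" ..
    obtain l1 r1 V1 where s1: "state ?L l1 r1 V1" "{l1<..<r1} \<subseteq> {l<..<r}" "2 * card V1 < card V"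
      using state_append_matched(2)[OF st q w m] by blast
    \<comment> \<open>For \<open>i = N\<close> the set \<open>V\<close> would be empty, which rules
      out a match.\<close>
    have "N - i \<noteq> 0" using s1 less.prems by (intro notI) auto
    then have iN: "i < N" by simp
    have "(2::nat) ^ (N - i) = 2 * 2 ^ (N - Suc i)"
      using iN by (metis Suc_diff_Suc power_Suc)
    then have "card V1 < 2 ^ (N - Suc i)" using s1 less.prems by linarith
    from less.hyps[OF _ s1(1) this] iN less.prems obtain J where
      J: "valid (?L @ J)" "fst ` set J \<subseteq> {l1<..<r1}"
        "profit (?L @ J) + 2 * R ^ i \<le> profit ?L + 2 / R * (total (?L @ J) - total ?L)"
      by fastforce
    \<comment> \<open>The surplus \<open>2 * R ^ i\<close> of the remaining escalation covers the
      gain \<open>1 + R ^ i\<close> of this match, and counting its weight in \<open>total\<close>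
      releases the surplus \<open>2 * R ^ (i - 1)\<close>.\<close>
    have "2 / R * (total (?L @ J) - total ?L) =
        2 / R * (total (?L @ J) - total L) - 2 * R ^ (i - 1)"
      unfolding tot using R Ri by (simp add: field_simps)
    then have "profit (?L @ J) + 2 * R ^ (i - 1) \<le> profit L + 2 / R * (total (?L @ J) - total L)"
      using J(3) state_append_matched(1)[OF st q w m] w by linarith
    then show ?thesis
      using J s1 q by (intro exI[of _ "(q, R ^ i) # J"]) auto
  qed
qed

lemma potential_decreases:
  fixes N :: nat and \<rho> :: real
  defines "R \<equiv> 2 ^ N :: real"
  defines "\<Phi> \<equiv> \<lambda>L V. profit L - \<rho> * total L + 4 / R * real (card V)"
  assumes st: "state L l r V" and U: "R ^ N \<le> U" and \<rho>: "4 / R < \<rho>"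
  shows "\<exists>L' l' r' V'. state L' l' r' V' \<and> \<Phi> L' V' \<le> \<Phi> L V - (\<rho> - 4 / R)"
proof -
  have R: "1 \<le> R" by (simp add: R_def)
  have \<rho>0: "0 < \<rho>" using \<rho> R by (smt (verit) divide_nonneg_pos)
  define q where "q = (l + r) / 2"
  have q: "l < q" "q < r" using st by (auto simp: state_def q_def)
  let ?L = "L @ [(q, 1)]"
  have v: "valid ?L" using valid_append_single[OF st q _ one_le_U] by simp
  have tot: "total ?L = total L + 1" by (simp add: OPT_append_single on_parabola_def)
  show ?thesis
  proof (cases "\<exists>j. (j, length L) \<in> pairs ?L")
    case False
    then have "profit ?L = profit L" using profit_append_unmatched[OF v] by blast
    moreover have "card (insert (length L) V) = card V + 1"
    proof -
      have "length L \<notin> V" using st unfolding state_def by blast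
      then show ?thesis using state_finite[OF st] by simp
    qed
    \<comment> \<open>The total grows by 1, at a price of \<rho>, and one more visible point adds
      \<open>4 / R\<close>.\<close>
    ultimately have "\<Phi> ?L (insert (length L) V) \<le> \<Phi> L V - (\<rho> - 4 / R)"
      unfolding \<Phi>_def tot by (simp add: algebra_simps add_divide_distrib)
    then show ?thesis using state_append_unmatched[OF st q] by blast
  next
    case True
    then obtain j where m: "(j, length L) \<in> pairs ?L" ..
    note gain = state_append_matched(1)[OF st q order.refl one_le_U m]
    obtain l1 r1 V1 l2 r2 V2 where s: "state ?L l1 r1 V1" "state ?L l2 r2 V2"
      "separated ?L {l1<..<r1} {l2<..<r2}" "2 * card V1 < card V" "card V2 < card V"
      using state_append_matched(2)[OF st q order.refl one_le_U m] by blast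
    show ?thesis
    proof (cases "card V < 2 ^ N")
      case False
      \<comment> \<open>At least \<open>R / 2\<close> visible points are lost, worth
        \<open>4 / R\<close> each; together they pay for the gain of 2.\<close>
      then have "2 ^ N \<le> 2 * card V - 2 * card V1" using s(4) by linarith
      then have "real (2 ^ N) \<le> real (2 * card V - 2 * card V1)" by (simp only: of_nat_le_iff)
      then have "R \<le> 2 * real (card V) - 2 * real (card V1)"
        using s(4) by (simp add: R_def of_nat_diff)
      then have "2 / R * R \<le> 2 / R * (2 * real (card V) - 2 * real (card V1))"
        using R by (intro mult_left_mono) auto
      then have "4 / R * real (card V1) \<le> 4 / R * real (card V) - 2"
        using R by (simp add: algebra_simps)
      moreover have "0 \<le> 4 / R" using R by simp
      ultimately have "\<Phi> ?L V1 \<le> \<Phi> L V - (\<rho> - 4 / R)"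
        unfolding \<Phi>_def tot distrib_left using gain by linarith
      then show ?thesis using s by blast
    next
      case True
      have N: "1 \<le> N" using True s(5) by (cases N) auto
      have "(2::nat) ^ N = 2 * 2 ^ (N - 1)" using N by (cases N) auto
      then have "card V1 < 2 ^ (N - 1)" using True s(4) by linarith
      \<comment> \<open>Starting at exponent 1, the escalation leaves a surplus of 2, exactly the
        bound on the gain from the unit-weight match before it.\<close>
      from escalation[OF s(1) this _ N] U obtain J where
        J: "valid (?L @ J)" "fst ` set J \<subseteq> {l1<..<r1}"
          "profit (?L @ J) + 2 \<le> profit ?L + 2 / R * (total (?L @ J) - total ?L)"
        by (auto simp: R_def)
      let ?L' = "?L @ J"
      have s': "state ?L' l2 r2 V2" using state_append_elsewhere[OF s(2,3) J(1,2)] .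
      have "total ?L \<le> total ?L'"
      proof -
        have "0 \<le> wt (on_parabola ?L') i" if "i < length ?L'" for i
          using J(1) that revealed_on_parabola[of ?L'] unfolding revealed_def by fastforce
        then have "(\<Sum>i<length ?L. wt (on_parabola ?L') i) \<le> total ?L'"
          unfolding OPT_def by (intro sum_mono2) auto
        moreover have "(\<Sum>i<length ?L. wt (on_parabola ?L') i) = total ?L"
          unfolding OPT_def by (intro sum.cong) (auto simp: nth_append)
        ultimately show ?thesis by simp
      qed
      \<comment> \<open>\<open>D\<close> is the weight sent in the whole round. The drop is at least
        \<open>(\<rho> - 4 / R) * D\<close>, and the first request already gives \<open>D\<close>
        the value 1 or more.\<close>
      define D where "D = total ?L' - total L"
      have D: "1 \<le> D" "total ?L' - total ?L = D - 1" "total ?L' = total L + D"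
        using \<open>total ?L \<le> total ?L'\<close> tot by (auto simp: D_def)
      have "profit ?L' \<le> profit L + 2 / R * (D - 1)"
        using J(3) gain unfolding D(2) by linarith
      also have "\<dots> \<le> profit L + 4 / R * D"
        using D R by (intro add_left_mono mult_mono divide_right_mono) auto
      finally have "profit ?L' - \<rho> * total ?L' \<le> profit L - \<rho> * total L - (\<rho> - 4 / R) * D"
        unfolding D(3) by (simp add: algebra_simps)
      moreover have "\<rho> - 4 / R \<le> (\<rho> - 4 / R) * D"
        using mult_left_mono[of 1 D "\<rho> - 4 / R"] D(1) \<rho> by simp
      moreover have "4 / R * real (card V2) \<le> 4 / R * real (card V)"
        using s(5) R by (intro mult_left_mono) auto
      ultimately have "\<Phi> ?L' V2 \<le> \<Phi> L V - (\<rho> - 4 / R)"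
        unfolding \<Phi>_def by (smt (verit))
      then show ?thesis using s' by blast
    qed
  qed
qed

section \<open>From the potential to the competitive ratio\<close>

text \<open>The game may stop at an odd length, which is not an instance. Dropping the last request
  does not raise the profit and lowers \<rho> times the total by at most
  \<open>\<rho> * U\<close>.\<close>

lemma competitive_any_length:
  assumes "competitive U \<rho> A" "0 \<le> \<rho>"
  shows "\<exists>c. \<forall>L. valid L \<longrightarrow> - c \<le> profit L - \<rho> * total L"
proof -
  obtain c where c: "\<And>I. instance_of U I \<Longrightarrow> ALG A I \<ge> \<rho> * OPT I - c"
    using assms unfolding competitive_def by blast
  have even_case: "- c \<le> profit L - \<rho> * total L" if "valid L" "even (length L)" for L
    using c[of "on_parabola L"] revealed_on_parabola[OF that(1)] that by (simp add: instance_of_def)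
  have "- (\<bar>c\<bar> + \<rho> * U) \<le> profit L - \<rho> * total L" if v: "valid L" for L
  proof (cases "even (length L)")
    case True
    then show ?thesis using even_case[OF v] assms(2) one_le_U
      by (smt (verit) mult_nonneg_nonneg)
  next
    case False
    then obtain K p where L: "L = K @ [p]" by (cases L rule: rev_exhaust) auto
    have vK: "valid K" using v L valid_appendD by blast
    have p: "snd p \<le> U" using v by (simp add: L valid_def)
    have "profit K \<le> profit L"
    proof -
      have "matched A (on_parabola K) \<subseteq> matched A (on_parabola L)"
        using matching_append[of A "on_parabola K" "on_parabola [p]"]
        unfolding matched_def L by fastforce
      moreover have "0 \<le> wt (on_parabola L) i" if "i < length L" for i
        using revealed_on_parabola[OF v] that unfolding revealed_def by fastforce
      ultimately have "(\<Sum>i\<in>matched A (on_parabola K). wt (on_parabola L) i) \<le> profit L"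
        unfolding ALG_def by (intro sum_mono2) (auto simp: matched_def)
      moreover have "(\<Sum>i\<in>matched A (on_parabola K). wt (on_parabola L) i) = profit K"
        unfolding ALG_def by (intro sum.cong) (auto simp: L matched_def nth_append)
      ultimately show ?thesis by simp
    qed
    moreover have "- c \<le> profit K - \<rho> * total K" using even_case[OF vK] False L by simp
    moreover have "\<rho> * total L \<le> \<rho> * total K + \<rho> * U"
      using mult_left_mono[OF p assms(2)]
      by (simp add: L OPT_append_single on_parabola_def algebra_simps)
    ultimately show ?thesis by linarith
  qed
  then show ?thesis by blast
qed

text \<open>Repeated rounds push the potential below every bound, whereas competitiveness bounds it
  from below, the term for visible points being nonnegative.\<close>

lemma not_competitive:
  assumes U: "(2 ^ N) ^ N \<le> U" and \<rho>: "4 / 2 ^ N < \<rho>"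
  shows "\<not> competitive U \<rho> A"
proof
  assume comp: "competitive U \<rho> A"
  have "0 < (4::real) / 2 ^ N" by simp
  then have "0 \<le> \<rho>" using \<rho> by linarith
  then obtain c where c: "\<And>L. valid L \<Longrightarrow> - c \<le> profit L - \<rho> * total L"
    using competitive_any_length[OF comp] by blast
  define \<delta> where "\<delta> = \<rho> - 4 / 2 ^ N"
  define \<Phi> where "\<Phi> L V = profit L - \<rho> * total L + 4 / 2 ^ N * real (card V)" for L and V :: "nat set"
  have "\<delta> > 0" using \<rho> by (simp add: \<delta>_def)
  have "\<exists>L l r V. state L l r V \<and> \<Phi> L V \<le> \<Phi> [] {} - real n * \<delta>" for n
  proof (induction n)
    case 0
    have "confined [] {0<..<1} {}" by (simp add: confined_def)
    then have "state [] 0 1 {}" by (auto simp: state_def valid_def)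
    then show ?case by fastforce
  next
    case (Suc n)
    then obtain L l r V where *: "state L l r V" "\<Phi> L V \<le> \<Phi> [] {} - real n * \<delta>" by blast
    obtain L' l' r' V' where "state L' l' r' V'" "\<Phi> L' V' \<le> \<Phi> L V - \<delta>"
      using potential_decreases[OF *(1) U \<rho>] unfolding \<Phi>_def \<delta>_def by blast
    then have "state L' l' r' V'" "\<Phi> L' V' \<le> \<Phi> [] {} - real (Suc n) * \<delta>"
      using *(2) by (simp_all add: algebra_simps)
    then show ?case by blast
  qed
  moreover have "- c \<le> \<Phi> L V" if "state L l r V" for L l r V
  proof -
    have "0 \<le> (4::real) / 2 ^ N * real (card V)" by simp
    then show ?thesis using that c[of L] unfolding \<Phi>_def state_def by linarith
  qed
  ultimately have "real n * \<delta> \<le> \<Phi> [] {} + c" for n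
    by (smt (verit))
  then show False
    using reals_Archimedean3[OF \<open>\<delta> > 0\<close>] by (meson not_le)
qed

end

theorem theorem3:
  shows "\<exists>C::real. C > 0 \<and>
    (\<forall>\<^sub>F U::real in at_top. \<forall>A. online_algorithm U A \<longrightarrow>
       (\<forall>\<rho>::real. \<rho> > C * 2 powr (- sqrt (log 2 U)) \<longrightarrow> \<not> competitive U \<rho> A))"
proof (intro exI[of _ 8] conjI eventually_mono[OF eventually_ge_at_top[of 1]] allI impI)
  fix U \<rho> :: real and A :: algorithm
  assume U: "1 \<le> U" and A: "online_algorithm U A" and \<rho>: "8 * 2 powr (- sqrt (log 2 U)) < \<rho>"
  interpret online_matching U A by unfold_locales fact+
  define s where "s = sqrt (log 2 U)"
  have s: "0 \<le> s" "s\<^sup>2 = log 2 U" using U by (auto simp: s_def)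
  \<comment> \<open>The largest integer not exceeding \<open>s\<close>; then \<open>N * N\<close> is
    at most \<open>log 2 U\<close>, so the weights up to \<open>(2 ^ N) ^ N\<close> are
    admissible.\<close>
  define N where "N = nat \<lfloor>s\<rfloor>"
  have N: "real N \<le> s" "s \<le> real N + 1"
    using s by (auto simp: N_def)
  have "real N * real N \<le> log 2 U"
    using mult_mono[OF N(1) N(1)] s by (simp add: power2_eq_square)
  then have "2 powr (real N * real N) \<le> U"
    using U by (metis le_log_iff less_le_trans one_less_numeral_iff semiring_norm(76) zero_less_one)
  then have "(2 ^ N) ^ N \<le> U"
    by (metis of_nat_mult power_mult powr_realpow zero_less_numeral)
  moreover have "4 / 2 ^ N < \<rho>"
  proof -
    have "(4::real) / 2 ^ N = 4 * 2 powr (- real N)"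
      by (simp add: powr_minus powr_realpow field_simps)
    \<comment> \<open>Rounding \<open>s\<close> down costs a factor of at most 2, which turns the
      constant 4 into 8.\<close>
    also have "\<dots> \<le> 4 * 2 powr (1 - s)"
      using N by simp
    also have "\<dots> = 8 * 2 powr (- s)"
      by (simp add: powr_diff powr_minus field_simps)
    finally show ?thesis using \<rho> by (simp add: s_def)
  qed
  ultimately show "\<not> competitive U \<rho> A" by (rule not_competitive)
qed simp

end
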